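(* Let $L(p,q)$ be a $3$-dimensional lens space with $p$ odd. Then its universal covering $f\colon S^3\to L(p,q)$ is a $3$-prem: there exists a map $g\colon S^3\to\mathbb{R}^3$ such that $f\times g\colon S^3\to L(p,q)\times\mathbb{R}^3$, $x\mapsto(f(x),g(x))$, is a smooth embedding.
   Context: $L(p,q)$ is the quotient of $S^3\subset\mathbb{C}^2$ by the free $\mathbb{Z}/p$-action generated by $(z,w)\mapsto(e^{2\pi i/p}z,e^{2\pi iq/p}w)$, $\gcd(p,q)=1$, with its standard smooth structure. *)

theory Defs
  imports "HOL-Analysis.Analysis"
begin

section \<open>Smooth maps between subsets of normed spaces\<close>

text \<open>For open \<open>S\<close> and a finite-dimensional domain, \<open>C_k_on k S f\<close> says that \<open>f\<close> is \<open>k\<close> times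
  continuously differentiable on \<open>S\<close>. It is meant for open \<open>S\<close> only.\<close>

primrec C_k_on :: "nat \<Rightarrow> 'a set \<Rightarrow> ('a::real_normed_vector \<Rightarrow> 'b::real_normed_vector) \<Rightarrow> bool" where
  "C_k_on 0 S f \<longleftrightarrow> continuous_on S f"
| "C_k_on (Suc k) S f \<longleftrightarrow>
     (\<forall>x\<in>S. f differentiable (at x)) \<and>
     (\<forall>v. C_k_on k S (\<lambda>x. frechet_derivative f (at x) v))"

definition smooth_on_open :: "'a set \<Rightarrow> ('a::real_normed_vector \<Rightarrow> 'b::real_normed_vector) \<Rightarrow> bool" where
  "smooth_on_open S f \<longleftrightarrow> open S \<and> (\<forall>k. C_k_on k S f)"

text \<open>On an arbitrary subset \<open>S\<close> of a Euclidean space, a map is smooth if near each point of \<open>S\<close> it is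
  the restriction of a smooth map defined on an open set of the ambient space.\<close>

definition smooth_on_subset :: "'a set \<Rightarrow> ('a::real_normed_vector \<Rightarrow> 'b::real_normed_vector) \<Rightarrow> bool" where
  "smooth_on_subset S f \<longleftrightarrow>
     (\<forall>x\<in>S. \<exists>U h. x \<in> U \<and> smooth_on_open U h \<and> (\<forall>y\<in>S \<inter> U. h y = f y))"


section \<open>Smooth manifolds and smooth embeddings\<close>

text \<open>A manifold is presented by its topology and an atlas of charts \<open>(U, \<phi>)\<close> with values in a fixed
  model space \<open>'e\<close>. Values of \<open>\<phi>\<close> outside \<open>U\<close> are irrelevant. The record imposes no axioms; the
  manifolds below are given by explicit atlases of pairwise compatible charts.\<close>

record ('a, 'e) manifold =
  mtop :: "'a topology"
  atlas :: "('a set \<times> ('a \<Rightarrow> 'e)) set"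

definition local_rep :: "'a set \<Rightarrow> ('a \<Rightarrow> 'e) \<Rightarrow> ('b \<Rightarrow> 'f) \<Rightarrow> ('a \<Rightarrow> 'b) \<Rightarrow> 'e \<Rightarrow> 'f" where
  "local_rep U \<phi> \<psi> f = (\<lambda>v. \<psi> (f (inv_into U \<phi> v)))"

definition smooth_map ::
  "('a, 'e::euclidean_space) manifold \<Rightarrow> ('b, 'f::euclidean_space) manifold \<Rightarrow> ('a \<Rightarrow> 'b) \<Rightarrow> bool" where
  "smooth_map M N f \<longleftrightarrow>
     f \<in> topspace (mtop M) \<rightarrow> topspace (mtop N) \<and>
     (\<forall>x \<in> topspace (mtop M). \<exists>(U, \<phi>) \<in> atlas M. \<exists>(V, \<psi>) \<in> atlas N.
        x \<in> U \<and> f ` U \<subseteq> V \<and> smooth_on_open (\<phi> ` U) (local_rep U \<phi> \<psi> f))"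

definition smooth_immersion ::
  "('a, 'e::euclidean_space) manifold \<Rightarrow> ('b, 'f::euclidean_space) manifold \<Rightarrow> ('a \<Rightarrow> 'b) \<Rightarrow> bool" where
  "smooth_immersion M N f \<longleftrightarrow>
     smooth_map M N f \<and>
     (\<forall>x \<in> topspace (mtop M). \<exists>(U, \<phi>) \<in> atlas M. \<exists>(V, \<psi>) \<in> atlas N.
        x \<in> U \<and> f ` U \<subseteq> V \<and>
        (\<exists>D. (local_rep U \<phi> \<psi> f has_derivative D) (at (\<phi> x)) \<and> inj D))"

definition smooth_embedding ::
  "('a, 'e::euclidean_space) manifold \<Rightarrow> ('b, 'f::euclidean_space) manifold \<Rightarrow> ('a \<Rightarrow> 'b) \<Rightarrow> bool" where
  "smooth_embedding M N f \<longleftrightarrow>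
     smooth_immersion M N f \<and> embedding_map (mtop M) (mtop N) f"

definition euclidean_manifold :: "('e::euclidean_space, 'e) manifold" where
  "euclidean_manifold = \<lparr>mtop = euclidean, atlas = {(UNIV, \<lambda>x. x)}\<rparr>"

definition product_manifold ::
  "('a, 'e) manifold \<Rightarrow> ('b, 'f) manifold \<Rightarrow> ('a \<times> 'b, 'e \<times> 'f) manifold" where
  "product_manifold M N =
     \<lparr>mtop = prod_topology (mtop M) (mtop N),
      atlas = {(U \<times> V, map_prod \<phi> \<psi>) | U \<phi> V \<psi>. (U, \<phi>) \<in> atlas M \<and> (V, \<psi>) \<in> atlas N}\<rparr>"

text \<open>An embedded submanifold \<open>S\<close> of a Euclidean space carries the maximal atlas of all
  diffeomorphisms from relatively open subsets of \<open>S\<close> onto open subsets of the model space.\<close>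

definition embedded_submanifold :: "'a::euclidean_space set \<Rightarrow> ('a, 'e::euclidean_space) manifold" where
  "embedded_submanifold S =
     \<lparr>mtop = top_of_set S,
      atlas = {(U, \<phi>). openin (top_of_set S) U \<and> inj_on \<phi> U \<and> smooth_on_subset U \<phi> \<and>
                        smooth_on_open (\<phi> ` U) (inv_into U \<phi>)}\<rparr>"

definition quotient_topology :: "'a topology \<Rightarrow> ('a \<Rightarrow> 'b) \<Rightarrow> 'b topology" where
  "quotient_topology X f =
     topology (\<lambda>V. V \<subseteq> f ` topspace X \<and> openin X {x \<in> topspace X. f x \<in> V})"

lemma openin_quotient_topology:
  "openin (quotient_topology X f) V \<longleftrightarrow>
     V \<subseteq> f ` topspace X \<and> openin X {x \<in> topspace X. f x \<in> V}"
proof -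
  have "istopology (\<lambda>V. V \<subseteq> f ` topspace X \<and> openin X {x \<in> topspace X. f x \<in> V})"
    unfolding istopology_def
  proof (intro conjI allI impI)
    fix S T
    assume S: "S \<subseteq> f ` topspace X \<and> openin X {x \<in> topspace X. f x \<in> S}"
      and T: "T \<subseteq> f ` topspace X \<and> openin X {x \<in> topspace X. f x \<in> T}"
    show "S \<inter> T \<subseteq> f ` topspace X" using S by blast
    have eq: "{x \<in> topspace X. f x \<in> S \<inter> T} =
          {x \<in> topspace X. f x \<in> S} \<inter> {x \<in> topspace X. f x \<in> T}" by blast
    show "openin X {x \<in> topspace X. f x \<in> S \<inter> T}"
      unfolding eq using S T by (intro openin_Int) (rule conjunct2, assumption)+
  next
    fix \<K>
    assume K: "\<forall>V\<in>\<K>. V \<subseteq> f ` topspace X \<and> openin X {x \<in> topspace X. f x \<in> V}"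
    show "\<Union>\<K> \<subseteq> f ` topspace X" using K by blast
    have eq: "{x \<in> topspace X. f x \<in> \<Union>\<K>} = (\<Union>V\<in>\<K>. {x \<in> topspace X. f x \<in> V})" by blast
    show "openin X {x \<in> topspace X. f x \<in> \<Union>\<K>}"
      unfolding eq by (intro openin_Union) (use K in auto)
  qed
  then show ?thesis
    unfolding quotient_topology_def by (simp add: topology_inverse')
qed

lemma topspace_quotient_topology [simp]:
  "topspace (quotient_topology X f) = f ` topspace X"
proof
  show "topspace (quotient_topology X f) \<subseteq> f ` topspace X"
    using openin_quotient_topology[of X f "topspace (quotient_topology X f)"] by simp
  have "{x \<in> topspace X. f x \<in> f ` topspace X} = topspace X" by blast
  then have "openin (quotient_topology X f) (f ` topspace X)"
    by (simp add: openin_quotient_topology)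
  then show "f ` topspace X \<subseteq> topspace (quotient_topology X f)"
    by (rule openin_subset)
qed

lemma quotient_map_quotient_topology:
  "quotient_map X (quotient_topology X f) f"
  unfolding quotient_map_def openin_quotient_topology topspace_quotient_topology by blast

text \<open>For the projection \<open>f\<close> onto the orbit space of a free smooth action of a finite group on \<open>M\<close>,
  this is the unique smooth structure that makes \<open>f\<close> a local diffeomorphism: the charts of the
  quotient are the charts of \<open>M\<close> on domains on which \<open>f\<close> is injective, transported along \<open>f\<close>.\<close>

definition quotient_manifold :: "('a, 'e) manifold \<Rightarrow> ('a \<Rightarrow> 'b) \<Rightarrow> ('b, 'e) manifold" where
  "quotient_manifold M f =
     \<lparr>mtop = quotient_topology (mtop M) f,
      atlas = {(f ` U, \<lambda>y. \<phi> (the_inv_into U f y)) | U \<phi>. (U, \<phi>) \<in> atlas M \<and> inj_on f U}\<rparr>"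


section \<open>Lens spaces\<close>

text \<open>The norm on \<open>complex \<times> complex\<close> is the Euclidean (Hermitian) one.\<close>

definition sphere3 :: "(complex \<times> complex, real ^ 3) manifold" where
  "sphere3 = embedded_submanifold (sphere 0 1)"

definition lens_generator :: "nat \<Rightarrow> int \<Rightarrow> complex \<times> complex \<Rightarrow> complex \<times> complex" where
  "lens_generator p q = (\<lambda>(z, w).
     (exp (2 * of_real pi * \<i> / of_nat p) * z, exp (2 * of_real pi * \<i> * of_int q / of_nat p) * w))"

text \<open>Points of the lens space are orbits; the generator has finite order, so its nonnegative
  powers already form the group.\<close>

definition lens_projection :: "nat \<Rightarrow> int \<Rightarrow> complex \<times> complex \<Rightarrow> (complex \<times> complex) set" where
  "lens_projection p q x = range (\<lambda>k. (lens_generator p q ^^ k) x)"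

definition lens_space :: "nat \<Rightarrow> int \<Rightarrow> ((complex \<times> complex) set, real ^ 3) manifold" where
  "lens_space p q = quotient_manifold sphere3 (lens_projection p q)"

end

theory Submission
  imports Defs
begin

text \<open>
  The covering is a local diffeomorphism, so pairing it with any smooth \<open>g\<close> gives an immersion; and
  as the sphere is compact and the target Hausdorff, the pair is an embedding as soon as it is
  injective. Hence the whole question is to find a smooth \<open>g\<close> on the sphere, with values in
  \<open>\<real> ^ 3\<close>, that is injective on every orbit. There is an explicit polynomial one.

  Put \<open>\<zeta> = exp (2 \<pi> \<i> / p)\<close> and choose \<open>m > 0\<close> with \<open>q * m\<close> congruent to \<open>-1\<close> modulo \<open>p\<close>. Then
  the \<open>k\<close>-th power of the generator multiplies \<open>z\<close> by \<open>t = \<zeta> ^ k\<close> and \<open>W = w ^ m\<close> by the inverse of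
  \<open>t\<close>. The complex number \<open>z + W\<close> becomes \<open>t * z + W / t\<close>; as \<open>t\<close> runs through the unit
  circle this traces an ellipse, possibly degenerate. Since \<open>z\<close> and \<open>W\<close> do not both vanish, a value
  is attained by at most two \<open>t\<close>, the roots of a quadratic equation; for the value at \<open>t = 1\<close> the
  other root is determined by \<open>t * z = W\<close>. So \<open>z + W\<close> separates the points of an orbit except for pairs of this kind, and
  these are separated by the real number \<open>Im (z * cnj W)\<close>: the substitution replaces \<open>z * cnj W\<close>
  by \<open>t\<^sup>2 * z * cnj W\<close>, which for \<open>W = t * z\<close> is the complex conjugate of \<open>z * cnj W\<close>. The two
  imaginary parts are opposite, and they vanish only if \<open>t\<close> is real, that is \<open>t = 1\<close> or \<open>t = -1\<close>.
  This is where \<open>p\<close> has to be odd: \<open>t ^ p = 1\<close> then excludes \<open>t = -1\<close>. (For even \<open>p\<close> the antipodal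
  map belongs to the group, and the Borsuk-Ulam theorem forbids any such \<open>g\<close>.) The computation is
  \<open>orbit_collision_trivial\<close>; \<open>separating_map_separates_orbits\<close> restates it for the group.

  What remains is to make the differential topology precise: smooth maps are closed under the
  arithmetic operations, the sphere has arbitrarily small charts around each point
  (\<open>sphere_chart_in_open\<close>), and the orbit space of a finite cyclic group is Hausdorff with a locally
  injective projection (\<open>Hausdorff_orbit_space\<close>, \<open>orbit_map_locally_injective\<close>).
\<close>

section \<open>Arithmetic of smooth maps\<close>

text \<open>The iterated derivatives at a point depend only on the values nearby, so on an open set a map may be
  replaced by one that agrees with it there.\<close>

lemma C_k_on_cong:
  assumes "open S" "C_k_on k S f" "\<And>x. x \<in> S \<Longrightarrow> f x = g x"
  shows "C_k_on k S g"
  using assms(2,3)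
proof (induction k arbitrary: f g)
  case 0
  then show ?case by (simp cong: continuous_on_cong)
next
  case (Suc k)
  have der: "g differentiable (at x)"
    "frechet_derivative f (at x) = frechet_derivative g (at x)" if "x \<in> S" for x
  proof -
    have f: "f differentiable (at x)" using Suc.prems(1) that by simp
    then show "g differentiable (at x)"
      using has_derivative_transform_within_open[OF _ \<open>open S\<close> that] Suc.prems(2)
      unfolding differentiable_def by blast
    show "frechet_derivative f (at x) = frechet_derivative g (at x)"
      using frechet_derivative_transform_within_open[OF f \<open>open S\<close> that] Suc.prems(2) by blast
  qed
  show ?case
    using Suc.prems(1) der(1) by (auto intro: Suc.IH simp: der(2))
qed

text \<open>The recursion of \<open>C_k_on\<close> with any known formula for the derivative in place of the derivative
  chosen by \<open>frechet_derivative\<close>; the closure properties below feed the rules of differentiation into it.\<close>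

lemma C_k_on_SucI:
  assumes "open S"
    and "\<And>x. x \<in> S \<Longrightarrow> (f has_derivative f' x) (at x)"
    and "\<And>v. C_k_on k S (\<lambda>x. f' x v)"
  shows "C_k_on (Suc k) S f"
  using assms frechet_derivative_at[OF assms(2)]
  by (auto simp: differentiable_def intro!: C_k_on_cong[OF \<open>open S\<close> assms(3)])

lemma C_k_on_has_derivative:
  "C_k_on (Suc k) S f \<Longrightarrow> x \<in> S \<Longrightarrow> (f has_derivative frechet_derivative f (at x)) (at x)"
  by (simp add: frechet_derivative_works)

lemma C_k_on_SucD: "C_k_on (Suc k) S f \<Longrightarrow> C_k_on k S f"
proof (induction k arbitrary: f)
  case 0
  then show ?case
    by (auto intro!: continuous_at_imp_continuous_on differentiable_imp_continuous_within)
next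
  case (Suc k)
  then show ?case by (subst C_k_on.simps) (metis C_k_on.simps(2))
qed

lemma C_k_on_const: "open S \<Longrightarrow> C_k_on k S (\<lambda>x. c)"
proof (induction k arbitrary: c)
  case (Suc k)
  show ?case by (rule C_k_on_SucI[where f' = "\<lambda>x v. 0"]) (auto intro: Suc)
qed simp

lemma C_k_on_linear:
  assumes "open S" "bounded_linear L" shows "C_k_on k S L"
proof (cases k)
  case (Suc n)
  show ?thesis
    unfolding Suc by (rule C_k_on_SucI[where f' = "\<lambda>x. L"])
      (use assms in \<open>auto intro: C_k_on_const bounded_linear_imp_has_derivative\<close>)
qed (use assms in \<open>simp add: linear_continuous_on\<close>)

lemma C_k_on_add:
  assumes "open S" "C_k_on k S f" "C_k_on k S g" shows "C_k_on k S (\<lambda>x. f x + g x)"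
  using assms(2,3)
proof (induction k arbitrary: f g)
  case 0
  then show ?case by (auto intro: continuous_intros)
next
  case (Suc k)
  show ?case
  proof (rule C_k_on_SucI[OF \<open>open S\<close>])
    show "((\<lambda>x. f x + g x) has_derivative
        (\<lambda>v. frechet_derivative f (at x) v + frechet_derivative g (at x) v)) (at x)" if "x \<in> S" for x
      using Suc.prems that by (intro has_derivative_add C_k_on_has_derivative)
  qed (use Suc in auto)
qed

text \<open>By the product rule, a derivative of a bilinear product is a sum of such products, so the claim for
  all factors is carried through the induction at once.\<close>

lemma C_k_on_bilinear:
  assumes "open S" "bounded_bilinear B" "C_k_on k S f" "C_k_on k S g"
  shows "C_k_on k S (\<lambda>x. B (f x) (g x))"
  using assms(3,4)
proof (induction k arbitrary: f g)
  case 0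
  then show ?case by (simp add: bounded_bilinear.continuous_on[OF assms(2)])
next
  case (Suc k)
  show ?case
  proof (rule C_k_on_SucI[OF \<open>open S\<close>])
    show "((\<lambda>x. B (f x) (g x)) has_derivative
        (\<lambda>v. B (f x) (frechet_derivative g (at x) v) + B (frechet_derivative f (at x) v) (g x))) (at x)"
      if "x \<in> S" for x
      using Suc.prems that
      by (intro bounded_bilinear.FDERIV[OF assms(2)] C_k_on_has_derivative)
    show "C_k_on k S (\<lambda>x. B (f x) (frechet_derivative g (at x) v)
        + B (frechet_derivative f (at x) v) (g x))" for v
    proof (rule C_k_on_add[OF \<open>open S\<close>])
      show "C_k_on k S (\<lambda>x. B (f x) (frechet_derivative g (at x) v))"
        by (rule Suc.IH) (use Suc.prems C_k_on_SucD in auto)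
      show "C_k_on k S (\<lambda>x. B (frechet_derivative f (at x) v) (g x))"
        by (rule Suc.IH) (use Suc.prems C_k_on_SucD in auto)
    qed
  qed
qed

text \<open>The derivative of \<open>1 / f\<close> is a product of \<open>1 / f\<close>, \<open>f'\<close> and \<open>1 / f\<close>, all of which are already
  known to be one degree less smooth.\<close>

lemma C_k_on_inverse:
  fixes f :: "'a::real_normed_vector \<Rightarrow> 'b::real_normed_div_algebra"
  assumes "open S" "C_k_on k S f" "\<And>x. x \<in> S \<Longrightarrow> f x \<noteq> 0"
  shows "C_k_on k S (\<lambda>x. inverse (f x))"
  using assms(2)
proof (induction k)
  case 0
  then show ?case using assms(3) by (auto intro: continuous_on_inverse)
next
  case (Suc k)
  have inv: "C_k_on k S (\<lambda>x. inverse (f x))"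
    by (rule Suc.IH[OF C_k_on_SucD[OF Suc.prems]])
  show ?case
  proof (rule C_k_on_SucI[OF \<open>open S\<close>])
    show "((\<lambda>x. inverse (f x)) has_derivative
        (\<lambda>v. - (inverse (f x) * frechet_derivative f (at x) v * inverse (f x)))) (at x)"
      if "x \<in> S" for x
      using Suc.prems that assms(3) by (intro Deriv.has_derivative_inverse C_k_on_has_derivative)
    have "C_k_on k S (\<lambda>x. (- inverse (f x) * frechet_derivative f (at x) v) * inverse (f x))" for v
      using Suc.prems inv C_k_on_bilinear[OF \<open>open S\<close> bounded_bilinear_mult C_k_on_const[OF \<open>open S\<close>] inv, of "-1"]
      by (intro C_k_on_bilinear[OF \<open>open S\<close> bounded_bilinear_mult]) auto
    then show "C_k_on k S (\<lambda>x. - (inverse (f x) * frechet_derivative f (at x) v * inverse (f x)))" for v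
      by simp
  qed
qed

lemma smooth_on_open_cong:
  "smooth_on_open S f \<Longrightarrow> (\<And>x. x \<in> S \<Longrightarrow> f x = g x) \<Longrightarrow> smooth_on_open S g"
  unfolding smooth_on_open_def using C_k_on_cong by blast

lemma smooth_on_open_const: "open S \<Longrightarrow> smooth_on_open S (\<lambda>x. c)"
  by (simp add: smooth_on_open_def C_k_on_const)

lemma smooth_on_open_linear: "open S \<Longrightarrow> bounded_linear L \<Longrightarrow> smooth_on_open S L"
  by (simp add: smooth_on_open_def C_k_on_linear)

lemma smooth_on_open_add:
  "smooth_on_open S f \<Longrightarrow> smooth_on_open S g \<Longrightarrow> smooth_on_open S (\<lambda>x. f x + g x)"
  by (simp add: smooth_on_open_def C_k_on_add)

lemma smooth_on_open_bilinear:
  "bounded_bilinear B \<Longrightarrow> smooth_on_open S f \<Longrightarrow> smooth_on_open S g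
    \<Longrightarrow> smooth_on_open S (\<lambda>x. B (f x) (g x))"
  by (simp add: smooth_on_open_def C_k_on_bilinear)

lemma smooth_on_open_inverse:
  fixes f :: "'a::real_normed_vector \<Rightarrow> 'b::real_normed_div_algebra"
  shows "smooth_on_open S f \<Longrightarrow> (\<And>x. x \<in> S \<Longrightarrow> f x \<noteq> 0) \<Longrightarrow> smooth_on_open S (\<lambda>x. inverse (f x))"
  by (simp add: smooth_on_open_def C_k_on_inverse)

text \<open>A bounded linear map after a smooth one is a product with a constant in disguise: evaluation
  is bilinear in the operator and its argument.\<close>

lemma smooth_on_open_linear_compose:
  assumes "bounded_linear L" "smooth_on_open S f"
  shows "smooth_on_open S (\<lambda>x. L (f x))"
proof -
  have "smooth_on_open S (\<lambda>x. blinfun_apply (Blinfun L) (f x))"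
    using assms(2)
    by (intro smooth_on_open_bilinear[OF bounded_bilinear_blinfun_apply] smooth_on_open_const)
      (simp_all add: smooth_on_open_def)
  then show ?thesis by (simp add: bounded_linear_Blinfun_apply assms(1))
qed

lemma smooth_on_open_power:
  fixes f :: "'a::real_normed_vector \<Rightarrow> 'b::real_normed_div_algebra"
  assumes "smooth_on_open S f" shows "smooth_on_open S (\<lambda>x. f x ^ n)"
proof (induction n)
  case 0
  have "open S" using assms by (simp add: smooth_on_open_def)
  then show ?case by (simp add: smooth_on_open_const)
next
  case (Suc n)
  show ?case
    unfolding power_Suc by (rule smooth_on_open_bilinear[OF bounded_bilinear_mult assms Suc])
qed

lemma smooth_on_open_Pair:
  assumes "smooth_on_open S f" "smooth_on_open S g"
  shows "smooth_on_open S (\<lambda>x. (f x, g x))"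
proof -
  have "smooth_on_open S (\<lambda>x. (f x, 0) + (0, g x))"
    using assms by (intro smooth_on_open_add
        smooth_on_open_linear_compose[of "\<lambda>y. (y, 0)"] smooth_on_open_linear_compose[of "\<lambda>y. (0, y)"])
      (auto intro: bounded_linear_Pair bounded_linear_ident bounded_linear_zero)
  then show ?thesis by simp
qed

lemma smooth_on_open_subset:
  assumes "smooth_on_open S f" "open T" "T \<subseteq> S" shows "smooth_on_open T f"
proof -
  have "C_k_on k T f" if "C_k_on k S f" for k
    using that assms(3)
    by (induction k arbitrary: f) (auto intro: continuous_on_subset)
  then show ?thesis using assms by (simp add: smooth_on_open_def)
qed

lemma smooth_on_open_has_derivative:
  assumes "smooth_on_open S f" "x \<in> S"
  shows "(f has_derivative frechet_derivative f (at x)) (at x)"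
  using assms C_k_on_has_derivative by (metis smooth_on_open_def)

lemma smooth_on_open_continuous_on: "smooth_on_open S f \<Longrightarrow> continuous_on S f"
  by (metis smooth_on_open_def C_k_on.simps(1))

section \<open>Charts of spheres\<close>

text \<open>Stereographic projection from the antipode of \<open>x\<close>. The hyperplane orthogonal to \<open>x\<close> has the dimension
  of the model space, so it can be identified with it by a linear isometry; then both the projection
  and its inverse are rational maps, which makes their smoothness a matter of arithmetic.\<close>

lemma sphere_stereographic:
  fixes x :: "'a::euclidean_space"
  assumes x: "norm x = 1" and dim: "DIM('a) = Suc DIM('e::euclidean_space)"
  obtains \<sigma> :: "'a \<Rightarrow> 'e::euclidean_space" and \<tau> :: "'e::euclidean_space \<Rightarrow> 'a"
  where "smooth_on_open {y. 1 + x \<bullet> y \<noteq> 0} \<sigma>" and "smooth_on_open UNIV \<tau>"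
    and "\<And>v. norm (\<tau> v) = 1" and "\<And>v. 1 + x \<bullet> \<tau> v \<noteq> 0" and "\<And>v. \<sigma> (\<tau> v) = v"
    and "\<And>y. norm y = 1 \<Longrightarrow> 1 + x \<bullet> y \<noteq> 0 \<Longrightarrow> \<tau> (\<sigma> y) = y"
proof -
  have xx: "x \<bullet> x = 1" using x by (simp add: norm_eq_1)
  have dims: "dim (UNIV :: 'e set) = dim {y. x \<bullet> y = 0}"
    using x dim by (subst dim_hyperplane) auto
  obtain J :: "'e \<Rightarrow> 'a" and K :: "'a \<Rightarrow> 'e"
    where lin: "linear J" "linear K" and J: "J ` UNIV = {y. x \<bullet> y = 0}"
      and nJ: "\<And>v. v \<in> UNIV \<Longrightarrow> norm (J v) = norm v"
      and nK: "\<And>y. y \<in> {y. x \<bullet> y = 0} \<Longrightarrow> norm (K y) = norm y"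
      and KJ: "\<And>v. v \<in> UNIV \<Longrightarrow> K (J v) = v"
      and JK: "\<And>y. y \<in> {y. x \<bullet> y = 0} \<Longrightarrow> J (K y) = y"
    by (rule isometries_subspaces[OF subspace_UNIV subspace_hyperplane dims]) blast
  have xJ: "x \<bullet> J v = 0" for v using J by blast
  \<comment> \<open>orthogonal projection along \<open>x\<close>, read in the coordinates of the hyperplane\<close>
  define L where "L y = K (y - (x \<bullet> y) *\<^sub>R x)" for y
  have proj: "x \<bullet> (y - (x \<bullet> y) *\<^sub>R x) = 0" for y by (simp add: inner_diff_right xx)
  have L: "bounded_linear L" unfolding L_def
    by (intro bounded_linear_compose[OF lin(2)[unfolded linear_conv_bounded_linear]]
        bounded_linear_sub bounded_linear_ident
        bounded_linear_compose[OF bounded_linear_scaleR_left] bounded_linear_inner_right)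
  define \<sigma> where "\<sigma> y = inverse (1 + x \<bullet> y) *\<^sub>R L y" for y
  \<comment> \<open>\<open>1 - v \<bullet> v\<close> appears as a sum with a scaled term, the form that the smoothness rules match\<close>
  define \<tau> where "\<tau> v = inverse (1 + v \<bullet> v) *\<^sub>R (J (2 *\<^sub>R v) + (1 + (-1) *\<^sub>R (v \<bullet> v)) *\<^sub>R x)" for v
  have pos: "1 + v \<bullet> v > 0" for v :: 'e by (smt (verit) inner_ge_zero)
  have op: "open {y. 1 + x \<bullet> y \<noteq> 0}" by (intro open_Collect_neq continuous_intros)
  show ?thesis
  proof
    show "smooth_on_open {y. 1 + x \<bullet> y \<noteq> 0} \<sigma>"
      unfolding \<sigma>_def
      by (intro smooth_on_open_bilinear[OF bounded_bilinear_scaleR] smooth_on_open_inverse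
          smooth_on_open_add smooth_on_open_const smooth_on_open_linear op bounded_linear_inner_right L)
        simp
    have I: "smooth_on_open UNIV (\<lambda>v::'e. v \<bullet> v)"
      by (intro smooth_on_open_bilinear[OF bounded_bilinear_inner] smooth_on_open_linear
          bounded_linear_ident open_UNIV)
    show "smooth_on_open UNIV \<tau>"
      unfolding \<tau>_def
      by (intro smooth_on_open_bilinear[OF bounded_bilinear_scaleR] smooth_on_open_inverse
          smooth_on_open_add smooth_on_open_const I open_UNIV
          smooth_on_open_linear_compose[OF lin(1)[unfolded linear_conv_bounded_linear]]
          smooth_on_open_linear bounded_linear_ident)
        (use pos in \<open>simp add: less_imp_neq[symmetric]\<close>)
    show "norm (\<tau> v) = 1" for v
    proof -
      have "J v \<bullet> J v = v \<bullet> v" using nJ[of v] by (simp add: norm_eq)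
      then have "(J (2 *\<^sub>R v) + (1 + (-1) *\<^sub>R (v \<bullet> v)) *\<^sub>R x) \<bullet> (J (2 *\<^sub>R v) + (1 + (-1) *\<^sub>R (v \<bullet> v)) *\<^sub>R x)
          = (1 + v \<bullet> v)\<^sup>2"
        using xJ[of v] by (simp add: linear_cmul[OF lin(1)] inner_add_left inner_add_right xx
            inner_commute[of "J v" x] power2_eq_square algebra_simps)
      then have "norm (J (2 *\<^sub>R v) + (1 + (-1) *\<^sub>R (v \<bullet> v)) *\<^sub>R x) = 1 + v \<bullet> v"
        using pos[of v] by (simp only: norm_eq_sqrt_inner) simp
      then show ?thesis unfolding \<tau>_def using pos[of v] by simp
    qed
    have x\<tau>: "x \<bullet> \<tau> v = inverse (1 + v \<bullet> v) * (1 - v \<bullet> v)" for v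
      by (simp add: \<tau>_def inner_add_right xJ xx)
    have x\<tau>1: "1 + x \<bullet> \<tau> v = 2 * inverse (1 + v \<bullet> v)" for v
      using pos[of v] by (simp add: x\<tau> field_simps)
    show "1 + x \<bullet> \<tau> v \<noteq> 0" for v using pos[of v] by (simp add: x\<tau>1)
    show "\<sigma> (\<tau> v) = v" for v
    proof -
      have "\<tau> v - (x \<bullet> \<tau> v) *\<^sub>R x = inverse (1 + v \<bullet> v) *\<^sub>R J (2 *\<^sub>R v)"
        by (simp add: x\<tau>) (simp add: \<tau>_def scaleR_add_right)
      then have "L (\<tau> v) = (2 * inverse (1 + v \<bullet> v)) *\<^sub>R v"
        by (simp add: L_def linear_cmul[OF lin(1)] linear_cmul[OF lin(2)] KJ)
      then show ?thesis using pos[of v] by (simp add: \<sigma>_def x\<tau>1)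
    qed
    show "\<tau> (\<sigma> y) = y" if y: "norm y = 1" "1 + x \<bullet> y \<noteq> 0" for y
    proof -
      define t where "t = x \<bullet> y"
      have t: "1 + t \<noteq> 0" using y by (simp add: t_def)
      have "L y \<bullet> L y = (y - t *\<^sub>R x) \<bullet> (y - t *\<^sub>R x)"
        using nK[of "y - t *\<^sub>R x"] proj by (simp add: L_def t_def norm_eq)
      also have "\<dots> = (1 - t) * (1 + t)"
        using y(1) by (simp add: inner_diff_left inner_diff_right xx norm_eq_1
            inner_commute[of y x] t_def[symmetric] algebra_simps)
      finally have LL: "L y \<bullet> L y = (1 - t) * (1 + t)" .
      have "\<sigma> y \<bullet> \<sigma> y = inverse (1 + t) * (inverse (1 + t) * (L y \<bullet> L y))"
        by (simp add: \<sigma>_def t_def[symmetric])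
      also have "\<dots> = (1 - t) / (1 + t)"
        unfolding LL using t by (simp add: divide_inverse)
      finally have \<sigma>\<sigma>: "\<sigma> y \<bullet> \<sigma> y = (1 - t) / (1 + t)" .
      have coeff: "1 + (-1) *\<^sub>R (\<sigma> y \<bullet> \<sigma> y) = 2 * t / (1 + t)"
        unfolding \<sigma>\<sigma> using t by (simp add: field_simps)
      have "1 + \<sigma> y \<bullet> \<sigma> y = 2 / (1 + t)"
        unfolding \<sigma>\<sigma> using t by (simp add: field_simps)
      then have coeff': "inverse (1 + \<sigma> y \<bullet> \<sigma> y) = (1 + t) / 2"
        by (simp only: inverse_divide)
      have "J (\<sigma> y) = inverse (1 + t) *\<^sub>R (y - t *\<^sub>R x)"
        using JK[of "y - t *\<^sub>R x"] proj by (simp add: \<sigma>_def L_def linear_cmul[OF lin(1)] t_def)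
      then have "\<tau> (\<sigma> y) = ((1 + t) / 2) *\<^sub>R (2 *\<^sub>R (inverse (1 + t) *\<^sub>R (y - t *\<^sub>R x)) + (2 * t / (1 + t)) *\<^sub>R x)"
        unfolding \<tau>_def coeff coeff' by (simp only: linear_cmul[OF lin(1)])
      also have "\<dots> = (y - t *\<^sub>R x) + t *\<^sub>R x"
        using t by (simp only: scaleR_add_right scaleR_scaleR) (simp add: field_simps)
      finally show ?thesis by simp
    qed
  qed
qed

text \<open>Restricting the stereographic chart centred at \<open>x\<close> to an open set gives a chart again, since the image
  of the restricted domain is the preimage of that open set under the smooth inverse.\<close>

lemma sphere_chart_in_open:
  fixes x :: "'a::euclidean_space"
  assumes x: "norm x = 1" and dim: "DIM('a) = Suc DIM('e::euclidean_space)"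
    and W: "open W" "x \<in> W"
  obtains U and \<phi> :: "'a \<Rightarrow> 'e::euclidean_space"
  where "(U, \<phi>) \<in> atlas (embedded_submanifold (sphere 0 1))" "x \<in> U" "U \<subseteq> W"
proof -
  obtain \<sigma> :: "'a \<Rightarrow> 'e" and \<tau> :: "'e \<Rightarrow> 'a"
    where \<sigma>: "smooth_on_open {y. 1 + x \<bullet> y \<noteq> 0} \<sigma>" and \<tau>: "smooth_on_open UNIV \<tau>"
      and n\<tau>: "\<And>v. norm (\<tau> v) = 1" and x\<tau>: "\<And>v. 1 + x \<bullet> \<tau> v \<noteq> 0" and \<sigma>\<tau>: "\<And>v. \<sigma> (\<tau> v) = v"
      and \<tau>\<sigma>: "\<And>y. norm y = 1 \<Longrightarrow> 1 + x \<bullet> y \<noteq> 0 \<Longrightarrow> \<tau> (\<sigma> y) = y"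
    using sphere_stereographic[OF x dim] by blast
  define U where "U = sphere 0 1 \<inter> (W \<inter> {y. 1 + x \<bullet> y \<noteq> 0})"
  have op: "open {y. 1 + x \<bullet> y \<noteq> 0}" using \<sigma> by (simp add: smooth_on_open_def)
  have inj: "inj_on \<sigma> U" by (rule inj_on_inverseI[of _ \<tau>]) (simp add: U_def \<tau>\<sigma>)
  have image: "\<sigma> ` U = \<tau> -` W"
  proof
    show "\<sigma> ` U \<subseteq> \<tau> -` W" by (auto simp: U_def \<tau>\<sigma>)
    show "\<tau> -` W \<subseteq> \<sigma> ` U"
      using n\<tau> x\<tau> \<sigma>\<tau> by (auto simp: U_def image_iff intro!: bexI[of _ "\<tau> _"])
  qed
  have "open (\<sigma> ` U)"
    unfolding image using smooth_on_open_continuous_on[OF \<tau>] W(1)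
    by (simp add: continuous_on_open_vimage)
  then have "smooth_on_open (\<sigma> ` U) \<tau>" by (rule smooth_on_open_subset[OF \<tau>]) simp
  then have inverse: "smooth_on_open (\<sigma> ` U) (inv_into U \<sigma>)"
  proof (rule smooth_on_open_cong)
    fix v assume "v \<in> \<sigma> ` U"
    then obtain y where "y \<in> U" "v = \<sigma> y" by blast
    then show "\<tau> v = inv_into U \<sigma> v" using inj by (simp add: \<tau>\<sigma> U_def)
  qed
  show ?thesis
  proof
    have "smooth_on_subset U \<sigma>"
      using \<sigma> by (auto simp: smooth_on_subset_def U_def
          intro!: exI[of _ "{y. 1 + x \<bullet> y \<noteq> 0}"] exI[of _ \<sigma>])
    moreover have "openin (top_of_set (sphere 0 1)) U"
      unfolding U_def using W(1) op by (intro openin_open_Int open_Int)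
    ultimately show "(U, \<sigma>) \<in> atlas (embedded_submanifold (sphere 0 1))"
      by (simp add: embedded_submanifold_def inj inverse)
    show "x \<in> U" using x W(2) by (simp add: U_def norm_eq_1)
    show "U \<subseteq> W" by (auto simp: U_def)
  qed
qed

section \<open>Immersions into products with a quotient manifold\<close>

text \<open>In the chart of the quotient transported from a chart \<open>\<phi>\<close> of \<open>M\<close>, the projection \<open>f\<close> is the
  identity. The pair is therefore represented by a graph \<open>v \<mapsto> (v, g v)\<close>, which is an immersion
  whatever the smooth map \<open>g\<close> is.\<close>

lemma smooth_immersion_quotient_pair:
  fixes M :: "('a, 'e::euclidean_space) manifold" and f :: "'a \<Rightarrow> 'b"
    and g :: "'a \<Rightarrow> 'f::euclidean_space"
  assumes "\<And>x. x \<in> topspace (mtop M) \<Longrightarrow>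
    \<exists>U \<phi>. (U, \<phi>) \<in> atlas M \<and> x \<in> U \<and> inj_on \<phi> U \<and> inj_on f U \<and>
      smooth_on_open (\<phi> ` U) (\<lambda>v. g (inv_into U \<phi> v))"
  shows "smooth_immersion M (product_manifold (quotient_manifold M f) euclidean_manifold)
    (\<lambda>x. (f x, g x))" (is "smooth_immersion M ?N ?F")
proof -
  have chart: "\<exists>U \<phi> V \<psi>. (U, \<phi>) \<in> atlas M \<and> (V, \<psi>) \<in> atlas ?N \<and> x \<in> U \<and> ?F ` U \<subseteq> V
      \<and> smooth_on_open (\<phi> ` U) (local_rep U \<phi> \<psi> ?F)
      \<and> (\<exists>D. (local_rep U \<phi> \<psi> ?F has_derivative D) (at (\<phi> x)) \<and> inj D)"
    if x: "x \<in> topspace (mtop M)" for x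
  proof -
    obtain U \<phi> where U: "(U, \<phi>) \<in> atlas M" "x \<in> U" and inj: "inj_on \<phi> U" "inj_on f U"
      and g: "smooth_on_open (\<phi> ` U) (\<lambda>v. g (inv_into U \<phi> v))"
      using assms[OF x] by blast
    \<comment> \<open>the chart of the quotient obtained by transporting \<open>\<phi>\<close> along \<open>f\<close>, on \<open>f ` U \<times> UNIV\<close>\<close>
    define \<psi> where "\<psi> = map_prod (\<lambda>y. \<phi> (the_inv_into U f y)) (\<lambda>z::'f. z)"
    have op: "open (\<phi> ` U)" using g by (simp add: smooth_on_open_def)
    have rep: "(v, g (inv_into U \<phi> v)) = local_rep U \<phi> \<psi> ?F v" if "v \<in> \<phi> ` U" for v
      using that inj by (auto simp: local_rep_def \<psi>_def the_inv_into_f_f)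
    have "smooth_on_open (\<phi> ` U) (\<lambda>v. (v, g (inv_into U \<phi> v)))"
      by (rule smooth_on_open_Pair[OF smooth_on_open_linear[OF op bounded_linear_ident] g])
    then have smooth: "smooth_on_open (\<phi> ` U) (local_rep U \<phi> \<psi> ?F)"
      by (rule smooth_on_open_cong) (rule rep)
    have \<phi>x: "\<phi> x \<in> \<phi> ` U" using U by blast
    obtain D where D: "((\<lambda>v. g (inv_into U \<phi> v)) has_derivative D) (at (\<phi> x))"
      using smooth_on_open_has_derivative[OF g \<phi>x] by blast
    have "(local_rep U \<phi> \<psi> ?F has_derivative (\<lambda>h. (h, D h))) (at (\<phi> x))"
      by (rule has_derivative_transform_within_open[OF _ op \<phi>x rep])
        (intro has_derivative_Pair has_derivative_ident D)
    moreover have "inj (\<lambda>h. (h, D h))" by (simp add: inj_on_def)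
    moreover have "(f ` U \<times> UNIV, \<psi>) \<in> atlas ?N"
      using U inj by (auto simp: product_manifold_def quotient_manifold_def euclidean_manifold_def \<psi>_def)
    moreover have "?F ` U \<subseteq> f ` U \<times> UNIV" by auto
    ultimately show ?thesis
      using U smooth by (intro exI[of _ U] exI[of _ \<phi>] exI[of _ "f ` U \<times> UNIV"] exI[of _ \<psi>]) blast
  qed
  have "?F \<in> topspace (mtop M) \<rightarrow> topspace (mtop ?N)"
    by (intro funcsetI) (simp add: product_manifold_def quotient_manifold_def euclidean_manifold_def)
  moreover have "\<exists>(U, \<phi>) \<in> atlas M. \<exists>(V, \<psi>) \<in> atlas ?N.
      x \<in> U \<and> ?F ` U \<subseteq> V \<and> smooth_on_open (\<phi> ` U) (local_rep U \<phi> \<psi> ?F)"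
    if x: "x \<in> topspace (mtop M)" for x
  proof -
    obtain U \<phi> V \<psi> where "(U, \<phi>) \<in> atlas M" "(V, \<psi>) \<in> atlas ?N" and "x \<in> U" "?F ` U \<subseteq> V"
      "smooth_on_open (\<phi> ` U) (local_rep U \<phi> \<psi> ?F)"
      using chart[OF x] by blast
    then show ?thesis
      by - (rule bexI[of _ "(U, \<phi>)"], unfold prod.case,
          rule bexI[of _ "(V, \<psi>)"], unfold prod.case, blast+)
  qed
  moreover have "\<exists>(U, \<phi>) \<in> atlas M. \<exists>(V, \<psi>) \<in> atlas ?N. x \<in> U \<and> ?F ` U \<subseteq> V \<and>
      (\<exists>D. (local_rep U \<phi> \<psi> ?F has_derivative D) (at (\<phi> x)) \<and> inj D)"
    if x: "x \<in> topspace (mtop M)" for x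
  proof -
    obtain U \<phi> V \<psi> where "(U, \<phi>) \<in> atlas M" "(V, \<psi>) \<in> atlas ?N" and "x \<in> U" "?F ` U \<subseteq> V"
      "\<exists>D. (local_rep U \<phi> \<psi> ?F has_derivative D) (at (\<phi> x)) \<and> inj D"
      using chart[OF x] by blast
    then show ?thesis
      by - (rule bexI[of _ "(U, \<phi>)"], unfold prod.case,
          rule bexI[of _ "(V, \<psi>)"], unfold prod.case, blast+)
  qed
  ultimately show ?thesis
    unfolding smooth_immersion_def smooth_map_def by (intro conjI ballI)
qed

section \<open>Orbits of periodic maps\<close>

lemma funpow_period:
  fixes \<gamma> :: "'a \<Rightarrow> 'a"
  assumes "\<gamma> ^^ p = id"
  shows "\<gamma> ^^ (j + p * k) = \<gamma> ^^ j"
  by (simp add: funpow_add funpow_mult[symmetric] assms)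

lemma finite_funpow_periodic:
  fixes \<gamma> :: "'a \<Rightarrow> 'a"
  assumes "\<gamma> ^^ p = id" "p > 0"
  shows "finite (range (\<lambda>k. \<gamma> ^^ k))"
proof (rule finite_subset)
  show "range (\<lambda>k. \<gamma> ^^ k) \<subseteq> (\<lambda>k. \<gamma> ^^ k) ` {..<p}"
  proof
    fix h assume "h \<in> range (\<lambda>k. \<gamma> ^^ k)"
    then obtain k where "h = \<gamma> ^^ k" by blast
    then have "h = \<gamma> ^^ (k mod p)"
      using funpow_period[OF assms(1), of "k mod p" "k div p"] by simp
    then show "h \<in> (\<lambda>k. \<gamma> ^^ k) ` {..<p}" using assms(2) by auto
  qed
qed simp

text \<open>A finite-order map is invertible, its inverse being one of its nonnegative powers; so moving the base
  point inside its orbit does not change the orbit, although only nonnegative powers are used.\<close>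

lemma orbit_funpow:
  fixes \<gamma> :: "'a \<Rightarrow> 'a"
  assumes "\<gamma> ^^ p = id" "p > 0"
  shows "range (\<lambda>j. (\<gamma> ^^ j) ((\<gamma> ^^ k) x)) = range (\<lambda>j. (\<gamma> ^^ j) x)"
proof
  show "range (\<lambda>j. (\<gamma> ^^ j) ((\<gamma> ^^ k) x)) \<subseteq> range (\<lambda>j. (\<gamma> ^^ j) x)"
    by (auto simp: funpow_add[unfolded o_def fun_eq_iff, rule_format, symmetric])
  show "range (\<lambda>j. (\<gamma> ^^ j) x) \<subseteq> range (\<lambda>j. (\<gamma> ^^ j) ((\<gamma> ^^ k) x))"
  proof
    fix y assume "y \<in> range (\<lambda>j. (\<gamma> ^^ j) x)"
    then obtain j where "y = (\<gamma> ^^ j) x" by blast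
    also have "\<dots> = (\<gamma> ^^ (j + p * k)) x" by (simp add: funpow_period[OF assms(1)])
    also have "j + p * k = (j + (p - 1) * k) + k" using assms(2) by (cases p) auto
    also have "(\<gamma> ^^ \<dots>) x = (\<gamma> ^^ (j + (p - 1) * k)) ((\<gamma> ^^ k) x)" by (simp add: funpow_add)
    finally show "y \<in> range (\<lambda>j. (\<gamma> ^^ j) ((\<gamma> ^^ k) x))" by blast
  qed
qed

lemma continuous_on_funpow:
  fixes \<gamma> :: "'a::topological_space \<Rightarrow> 'a"
  assumes "continuous_on UNIV \<gamma>" shows "continuous_on UNIV (\<gamma> ^^ k)"
proof (induction k)
  case (Suc k)
  show ?case
    using continuous_on_compose[OF Suc continuous_on_subset[OF assms subset_UNIV]] by simp
qed (simp add: id_def)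

text \<open>The saturation of a closed set is a union of finitely many preimages of it, hence closed.\<close>

lemma orbit_map_closed:
  fixes \<gamma> :: "'a::topological_space \<Rightarrow> 'a"
  assumes period: "\<gamma> ^^ p = id" "p > 0" and cont: "continuous_on UNIV \<gamma>"
    and inv: "\<gamma> ` S \<subseteq> S"
  defines "\<pi> \<equiv> \<lambda>x. range (\<lambda>k. (\<gamma> ^^ k) x)"
  shows "closed_map (top_of_set S) (quotient_topology (top_of_set S) \<pi>) \<pi>"
  unfolding closed_map_def
proof (intro allI impI)
  fix C assume C: "closedin (top_of_set S) C"
  have CS: "C \<subseteq> S" using closedin_subset[OF C] by simp
  have preimage: "{x \<in> S. \<pi> x \<in> \<pi> ` C} = (\<Union>h\<in>range (\<lambda>k. \<gamma> ^^ k). S \<inter> h -` C)"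
  proof (intro equalityI subsetI)
    fix x assume x: "x \<in> {x \<in> S. \<pi> x \<in> \<pi> ` C}"
    then obtain c where c: "c \<in> C" "\<pi> x = \<pi> c" by blast
    have "c \<in> \<pi> c" unfolding \<pi>_def by (rule range_eqI[of _ _ 0]) simp
    then have "c \<in> \<pi> x" using c by simp
    then show "x \<in> (\<Union>h\<in>range (\<lambda>k. \<gamma> ^^ k). S \<inter> h -` C)"
      using x c(1) by (auto simp: \<pi>_def)
  next
    fix x assume "x \<in> (\<Union>h\<in>range (\<lambda>k. \<gamma> ^^ k). S \<inter> h -` C)"
    then obtain k where k: "x \<in> S" "(\<gamma> ^^ k) x \<in> C" by auto
    have "\<pi> x = \<pi> ((\<gamma> ^^ k) x)" unfolding \<pi>_def by (rule orbit_funpow[OF period, symmetric])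
    then show "x \<in> {x \<in> S. \<pi> x \<in> \<pi> ` C}" using k by blast
  qed
  have closed: "closedin (top_of_set S) (S \<inter> (\<gamma> ^^ k) -` C)" for k
  proof (rule continuous_closedin_preimage_gen[OF _ _ C])
    show "continuous_on S (\<gamma> ^^ k)"
      using continuous_on_funpow[OF cont] continuous_on_subset by blast
    show "(\<gamma> ^^ k) \<in> S \<rightarrow> S" using inv by (induction k) (auto simp: Pi_iff)
  qed
  have "closedin (top_of_set S) (\<Union>h\<in>range (\<lambda>k. \<gamma> ^^ k). S \<inter> h -` C)"
    using finite_funpow_periodic[OF period] closed by (intro closedin_Union) auto
  then have "closedin (top_of_set S) {x \<in> topspace (top_of_set S). \<pi> x \<in> \<pi> ` C}"
    by (simp add: preimage)
  moreover have "\<pi> ` C \<subseteq> \<pi> ` S" using CS by blast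
  ultimately show "closedin (quotient_topology (top_of_set S) \<pi>) (\<pi> ` C)"
    using quotient_map_quotient_topology[of "top_of_set S" \<pi>]
    by (simp add: quotient_map_closedin)
qed

text \<open>A compact Hausdorff space is normal, and normality together with the Hausdorff property passes to
  images under closed continuous maps.\<close>

lemma Hausdorff_orbit_space:
  fixes \<gamma> :: "'a::t2_space \<Rightarrow> 'a"
  assumes "\<gamma> ^^ p = id" "p > 0" "continuous_on UNIV \<gamma>" "\<gamma> ` S \<subseteq> S" "compact S"
  shows "Hausdorff_space (quotient_topology (top_of_set S) (\<lambda>x. range (\<lambda>k. (\<gamma> ^^ k) x)))"
proof -
  have "Hausdorff_space (top_of_set S)"
    by (intro Hausdorff_space_subtopology) (simp add: Hausdorff_space_def, metis disjnt_def hausdorff)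
  moreover from this have "normal_space (top_of_set S)"
    using assms(5) by (simp add: compact_Hausdorff_or_regular_imp_normal_space compact_space_subtopology)
  ultimately show ?thesis
    using normal_Hausdorff_space_closed_continuous_map_image[OF _ _ orbit_map_closed[OF assms(1-4)]]
      quotient_imp_continuous_map[OF quotient_map_quotient_topology] by fastforce
qed

text \<open>For one map, intersect disjoint neighbourhoods of \<open>x\<close> and \<open>h x\<close>, the latter pulled back along \<open>h\<close>;
  finiteness of \<open>H\<close> allows shrinking once for each map.\<close>

lemma avoiding_neighbourhood:
  fixes x :: "'a::t2_space"
  assumes "finite H" and "\<And>h. h \<in> H \<Longrightarrow> continuous_on UNIV h" and "\<And>h. h \<in> H \<Longrightarrow> h x \<noteq> x"
  shows "\<exists>W. open W \<and> x \<in> W \<and> (\<forall>h\<in>H. \<forall>y\<in>W. h y \<notin> W)"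
  using assms
proof (induction H rule: finite_induct)
  case (insert h H)
  then obtain W where W: "open W" "x \<in> W" "\<forall>h\<in>H. \<forall>y\<in>W. h y \<notin> W" by auto
  obtain A B where AB: "open A" "open B" "x \<in> A" "h x \<in> B" "A \<inter> B = {}"
    using hausdorff[of x "h x"] insert.prems(2)[of h] by auto
  have "open (h -` B)" using insert.prems(1)[of h] AB(2) by (simp add: continuous_on_open_vimage)
  then show ?case using W AB by (intro exI[of _ "W \<inter> A \<inter> h -` B"]) auto
qed auto

text \<open>Two points of one orbit differ by a power of \<open>\<gamma>\<close>. There are only finitely many powers, and those
  other than the identity move \<open>x\<close>, so they cannot relate two points of a small neighbourhood.\<close>

lemma orbit_map_locally_injective:
  fixes \<gamma> :: "'a::t2_space \<Rightarrow> 'a"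
  assumes period: "\<gamma> ^^ p = id" "p > 0" and cont: "continuous_on UNIV \<gamma>"
    and free: "\<And>k. (\<gamma> ^^ k) x = x \<Longrightarrow> \<gamma> ^^ k = id"
  obtains W where "open W" "x \<in> W" "inj_on (\<lambda>x. range (\<lambda>k. (\<gamma> ^^ k) x)) W"
proof -
  have "\<exists>W. open W \<and> x \<in> W \<and> (\<forall>h\<in>range (\<lambda>k. \<gamma> ^^ k) - {id}. \<forall>y\<in>W. h y \<notin> W)"
    by (rule avoiding_neighbourhood)
      (use finite_funpow_periodic[OF period] continuous_on_funpow[OF cont] free in auto)
  then obtain W where W: "open W" "x \<in> W"
    and avoid: "\<And>h y. h \<in> range (\<lambda>k. \<gamma> ^^ k) - {id} \<Longrightarrow> y \<in> W \<Longrightarrow> h y \<notin> W" by blast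
  have "inj_on (\<lambda>x. range (\<lambda>k. (\<gamma> ^^ k) x)) W"
  proof (rule inj_onI)
    fix a b assume ab: "a \<in> W" "b \<in> W" and eq: "range (\<lambda>k. (\<gamma> ^^ k) a) = range (\<lambda>k. (\<gamma> ^^ k) b)"
    have "b \<in> range (\<lambda>k. (\<gamma> ^^ k) b)" by (rule range_eqI[of _ _ 0]) simp
    then obtain k where "b = (\<gamma> ^^ k) a" unfolding eq[symmetric] by blast
    moreover from this have "\<gamma> ^^ k = id" using avoid[of "\<gamma> ^^ k" a] ab by auto
    ultimately show "a = b" by simp
  qed
  then show ?thesis using that W by blast
qed

section \<open>The lens space action\<close>

text \<open>With integer exponents, roots of unity turn every question about powers of the generator into one
  about divisibility by \<open>p\<close>.\<close>

definition unity_root :: "nat \<Rightarrow> int \<Rightarrow> complex" where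
  "unity_root p a = exp (2 * of_real pi * \<i> * of_int a / of_nat p)"

lemma unity_root_add: "unity_root p (a + b) = unity_root p a * unity_root p b"
  by (simp add: unity_root_def exp_add[symmetric] add_divide_distrib distrib_left)

lemma unity_root_power: "unity_root p a ^ k = unity_root p (a * int k)"
  by (induction k) (simp_all add: unity_root_add distrib_left unity_root_def[of p 0])

lemma unity_root_dvd: "p > 0 \<Longrightarrow> int p dvd a \<Longrightarrow> unity_root p a = 1"
  unfolding unity_root_def dvd_def exp_eq_1 by auto

lemma unity_root_eq_1D:
  assumes "p > 0" "unity_root p a = 1" shows "int p dvd a"
proof -
  obtain n :: int where "2 * pi * a / p = 2 * n * pi"
    using assms(2) unfolding unity_root_def exp_eq_1 by (auto simp: Im_divide_of_nat)
  then have "real_of_int a = real_of_int (n * int p)" using assms(1) by (simp add: field_simps)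
  then show ?thesis by (simp only: of_int_eq_iff) simp
qed

lemma norm_unity_root: "norm (unity_root p a) = 1"
  by (simp add: unity_root_def norm_exp_eq_Re Re_divide_of_nat)

lemma lens_generator_unity_root:
  "lens_generator p q (z, w) = (unity_root p 1 * z, unity_root p q * w)"
  by (simp add: lens_generator_def unity_root_def)

lemma lens_generator_funpow:
  "(lens_generator p q ^^ k) (z, w) = (unity_root p (int k) * z, unity_root p (q * int k) * w)"
proof (induction k)
  case (Suc k)
  then show ?case
    by (simp add: lens_generator_unity_root) (simp add: unity_root_add distrib_left mult_ac)
qed (simp add: unity_root_def)

lemma lens_generator_period: "p > 0 \<Longrightarrow> lens_generator p q ^^ p = id"
  by (simp add: fun_eq_iff lens_generator_funpow unity_root_dvd)

lemma lens_generator_sphere: "lens_generator p q ` sphere 0 1 \<subseteq> sphere 0 1"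
  by (auto simp: lens_generator_unity_root norm_Pair norm_mult norm_unity_root)

lemma continuous_on_lens_generator: "continuous_on UNIV (lens_generator p q)"
  unfolding lens_generator_def case_prod_beta by (intro continuous_intros)

section \<open>A polynomial map that is injective on orbits\<close>

lemma coprime_obtains_negative_inverse:
  assumes "p > 0" "coprime (int p) q"
  obtains m :: nat where "m > 0" "int p dvd q * int m + 1"
proof -
  obtain u v where "u * int p + v * q = 1"
    using bezout_int[of "int p" q] assms(2) by (metis coprime_imp_gcd_eq_1)
  then have uv: "q * v = 1 - u * int p" by (simp add: algebra_simps)
  \<comment> \<open>\<open>- v\<close> is the inverse sought; a multiple of \<open>p\<close> larger than \<open>\<bar>v\<bar>\<close> makes it positive\<close>
  define n where "n = - v + (\<bar>v\<bar> + 1) * int p"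
  have "\<bar>v\<bar> + 1 \<le> (\<bar>v\<bar> + 1) * int p" using assms(1) mult_left_mono[of 1 "int p" "\<bar>v\<bar> + 1"] by simp
  then have "n > 0" unfolding n_def by linarith
  moreover have "q * n + 1 = int p * (u + q * (\<bar>v\<bar> + 1))"
    unfolding n_def distrib_left by (simp add: uv algebra_simps)
  ultimately show ?thesis by (intro that[of "nat n"]) auto
qed

text \<open>Here \<open>t\<close> and \<open>s\<close> are the factors by which a group element multiplies \<open>z\<close> and \<open>w\<close>. The equation for
  \<open>z + w ^ m\<close> factors as \<open>(t - 1) * (z - W / t) = 0\<close> with \<open>W = w ^ m\<close>. If \<open>t \<noteq> 1\<close>, then
  \<open>z = W / t\<close>, and the substitution swaps \<open>z\<close> and \<open>W\<close>: it conjugates \<open>z * cnj W\<close>. Equality of the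
  imaginary parts then says that \<open>t * (norm z)\<^sup>2\<close> is real; \<open>z\<close> cannot vanish, since \<open>w\<close> would vanish
  with it, so \<open>t\<close> is a real root of unity of odd order.\<close>

lemma orbit_collision_trivial:
  fixes t s z w :: complex
  assumes "odd p" "t ^ p = 1" "s ^ m * t = 1" "m > 0" "(z, w) \<noteq> 0"
    and u: "t * z + (s * w) ^ m = z + w ^ m"
    and v: "Im (t * z * cnj ((s * w) ^ m)) = Im (z * cnj (w ^ m))"
  shows "t = 1"
proof (rule ccontr)
  assume t1: "t \<noteq> 1"
  define W where "W = w ^ m"
  define W' where "W' = (s * w) ^ m"
  have W: "W = t * W'" using assms(3)
    by (simp add: W_def W'_def power_mult_distrib mult.commute mult.left_commute[of t])
  have "(t - 1) * z = (t - 1) * W'" using u by (fold W_def W'_def) (simp add: W algebra_simps)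
  then have z: "z = W'" using t1 by simp
  have "Im (W * cnj W') = Im (W' * cnj W)"
    using v by (fold W_def W'_def) (simp add: z W mult_ac)
  then have "Im (t * W' * cnj W') = 0" unfolding W by (simp add: algebra_simps)
  then have "Im t * (norm W')\<^sup>2 = 0"
    by (simp add: mult.assoc complex_norm_square[symmetric] flip: of_real_power)
  moreover have "W' \<noteq> 0"
    using z W assms(4,5) by (auto simp: W_def zero_prod_def)
  ultimately have "Im t = 0" by simp
  then have tr: "t = of_real (Re t)" by (simp add: complex_eq_iff)
  then have "Re t ^ p = 1" using assms(2) by (metis of_real_eq_1_iff of_real_power)
  then have "Re t = 1" using \<open>odd p\<close> by (metis odd_real_root_unique power_one)
  with tr t1 show False by simp
qed

text \<open>The target \<open>complex \<times> real\<close> stands for \<open>\<real> ^ 3\<close>, so that the first component can be computed with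
  as a single complex number.\<close>

definition separating_map :: "nat \<Rightarrow> complex \<times> complex \<Rightarrow> complex \<times> real" where
  "separating_map m = (\<lambda>(z, w). (z + w ^ m, Im (z * cnj (w ^ m))))"

lemma smooth_separating_map:
  assumes h: "smooth_on_open S h"
  shows "smooth_on_open S (\<lambda>v. separating_map m (h v))"
proof -
  have z: "smooth_on_open S (\<lambda>v. fst (h v))"
    by (rule smooth_on_open_linear_compose[OF bounded_linear_fst h])
  have W: "smooth_on_open S (\<lambda>v. snd (h v) ^ m)"
    by (rule smooth_on_open_power[OF smooth_on_open_linear_compose[OF bounded_linear_snd h]])
  have "smooth_on_open S (\<lambda>v. (fst (h v) + snd (h v) ^ m, Im (fst (h v) * cnj (snd (h v) ^ m))))"
    by (intro smooth_on_open_Pair smooth_on_open_add[OF z W] z W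
        smooth_on_open_linear_compose[OF bounded_linear_Im]
        smooth_on_open_bilinear[OF bounded_bilinear_mult]
        smooth_on_open_linear_compose[OF bounded_linear_cnj])
  then show ?thesis by (simp add: separating_map_def case_prod_beta)
qed

text \<open>The congruence on \<open>m\<close> makes the factors of \<open>w ^ m\<close> and of \<open>z\<close> inverse to each other. The
  conclusion that the group element is the identity also yields freeness of the action away from the
  origin, for a point fixed by a group element is in particular not separated from its image.\<close>

lemma separating_map_separates_orbits:
  assumes "odd p" "int p dvd q * int m + 1" "m > 0" "x \<noteq> 0"
    and eq: "separating_map m ((lens_generator p q ^^ k) x) = separating_map m x"
  shows "lens_generator p q ^^ k = id"
proof -
  have p: "p > 0" using assms(1) by (cases p) auto
  obtain z w where x: "x = (z, w)" by (cases x)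
  define t where "t = unity_root p (int k)"
  define s where "s = unity_root p (q * int k)"
  have "t ^ p = 1" unfolding t_def unity_root_power by (rule unity_root_dvd[OF p]) simp
  moreover have "s ^ m * t = unity_root p (int k * (q * int m + 1))"
    unfolding t_def s_def unity_root_power unity_root_add[symmetric] by (simp add: algebra_simps)
  moreover have "\<dots> = 1" using assms(2) by (intro unity_root_dvd[OF p]) simp
  moreover have "(z, w) \<noteq> 0" using assms(4) x by simp
  moreover have "t * z + (s * w) ^ m = z + w ^ m"
    "Im (t * z * cnj ((s * w) ^ m)) = Im (z * cnj (w ^ m))"
    using eq unfolding x lens_generator_funpow separating_map_def t_def s_def prod.case
    by (simp_all only: prod.inject)
  ultimately have "t = 1"
    using orbit_collision_trivial[OF assms(1) _ _ assms(3)] by metis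
  then have "int p dvd int k" unfolding t_def by (rule unity_root_eq_1D[OF p])
  then have "unity_root p (int k) = 1" "unity_root p (q * int k) = 1"
    using unity_root_dvd[OF p] by simp_all
  then show ?thesis by (simp add: fun_eq_iff lens_generator_funpow)
qed

section \<open>The embedding\<close>

theorem corollary1p11:
  fixes p :: nat and q :: int
  assumes "odd p" and "coprime (int p) q"
  shows "\<exists>g :: complex \<times> complex \<Rightarrow> real ^ 3.
           smooth_embedding sphere3 (product_manifold (lens_space p q) euclidean_manifold)
             (\<lambda>x. (lens_projection p q x, g x))"
proof -
  have p: "p > 0" using assms(1) by (cases p) auto
  obtain m where m: "m > 0" "int p dvd q * int m + 1"
    using coprime_obtains_negative_inverse[OF p assms(2)] .
  \<comment> \<open>any linear identification of the target of the separating map with \<open>\<real> ^ 3\<close>\<close>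
  obtain T :: "complex \<times> real \<Rightarrow> real ^ 3" and T' where T: "linear T" and T': "\<And>y. T' (T y) = y"
    by (rule isomorphisms_UNIV_UNIV[where 'M = "complex \<times> real" and 'N = "real ^ 3"]) auto
  define g where "g x = T (separating_map m x)" for x
  let ?S = "sphere 0 1 :: (complex \<times> complex) set"
  let ?\<pi> = "lens_projection p q"
  have \<pi>: "?\<pi> = (\<lambda>x. range (\<lambda>k. (lens_generator p q ^^ k) x))"
    by (simp add: fun_eq_iff lens_projection_def)
  have top: "mtop sphere3 = top_of_set ?S"
    by (simp add: sphere3_def embedded_submanifold_def)
  have g_smooth: "smooth_on_open A (\<lambda>v. g (h v))" if "smooth_on_open A h"
    for A and h :: "'v::real_normed_vector \<Rightarrow> complex \<times> complex"
    unfolding g_def using T linear_conv_bounded_linear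
    by (intro smooth_on_open_linear_compose[of T] smooth_separating_map that) blast
  have separates: "lens_generator p q ^^ k = id"
    if "x \<in> ?S" "g ((lens_generator p q ^^ k) x) = g x" for x k
  proof (rule separating_map_separates_orbits[OF assms(1) m(2) m(1)])
    show "x \<noteq> 0" using that(1) by auto
    show "separating_map m ((lens_generator p q ^^ k) x) = separating_map m x"
      using arg_cong[OF that(2)[unfolded g_def], of T'] by (simp only: T')
  qed
  have "smooth_immersion sphere3 (product_manifold (lens_space p q) euclidean_manifold)
      (\<lambda>x. (?\<pi> x, g x))"
    unfolding lens_space_def
  proof (rule smooth_immersion_quotient_pair)
    fix x assume "x \<in> topspace (mtop sphere3)"
    then have x: "x \<in> ?S" by (simp add: top)
    obtain W where W: "open W" "x \<in> W" "inj_on ?\<pi> W"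
      unfolding \<pi>
      by (rule orbit_map_locally_injective[OF lens_generator_period[OF p] p
            continuous_on_lens_generator, of q x])
        (use separates[OF x] in auto)
    obtain U and \<phi> :: "complex \<times> complex \<Rightarrow> real ^ 3" where
      U: "(U, \<phi>) \<in> atlas (embedded_submanifold ?S)" "x \<in> U" "U \<subseteq> W"
      by (rule sphere_chart_in_open[of x W, where 'e = "real ^ 3"]) (use x W in auto)
    then have inj: "inj_on \<phi> U" and inverse: "smooth_on_open (\<phi> ` U) (inv_into U \<phi>)"
      by (simp_all add: embedded_submanifold_def)
    show "\<exists>U \<phi>. (U, \<phi>) \<in> atlas sphere3 \<and> x \<in> U \<and> inj_on \<phi> U \<and> inj_on ?\<pi> U \<and>
        smooth_on_open (\<phi> ` U) (\<lambda>v. g (inv_into U \<phi> v))"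
      unfolding sphere3_def
      by (intro exI[of _ U] exI[of _ \<phi>] conjI U inj inj_on_subset[OF W(3) U(3)] g_smooth[OF inverse])
  qed
  moreover have "embedding_map (mtop sphere3)
      (mtop (product_manifold (lens_space p q) euclidean_manifold)) (\<lambda>x. (?\<pi> x, g x))"
  proof (rule continuous_imp_embedding_map)
    have "continuous_on UNIV g"
      using smooth_on_open_continuous_on[OF g_smooth[OF smooth_on_open_linear[OF open_UNIV bounded_linear_ident]]] .
    then have "continuous_map (mtop sphere3) euclidean g"
      unfolding top using continuous_on_subset by fastforce
    moreover have "continuous_map (mtop sphere3) (quotient_topology (mtop sphere3) ?\<pi>) ?\<pi>"
      by (rule quotient_imp_continuous_map[OF quotient_map_quotient_topology])
    ultimately show "continuous_map (mtop sphere3)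
        (mtop (product_manifold (lens_space p q) euclidean_manifold)) (\<lambda>x. (?\<pi> x, g x))"
      by (simp add: product_manifold_def lens_space_def quotient_manifold_def euclidean_manifold_def
          continuous_map_pairedI)
    show "compact_space (mtop sphere3)"
      by (simp add: top compact_space_subtopology)
    have "Hausdorff_space (quotient_topology (mtop sphere3) ?\<pi>)"
      unfolding top \<pi>
      by (intro Hausdorff_orbit_space[OF lens_generator_period[OF p] p continuous_on_lens_generator
            lens_generator_sphere]) simp
    then show "Hausdorff_space (mtop (product_manifold (lens_space p q) euclidean_manifold))"
      by (simp add: product_manifold_def lens_space_def quotient_manifold_def euclidean_manifold_def
          Hausdorff_space_prod_topology)
    show "inj_on (\<lambda>x. (?\<pi> x, g x)) (topspace (mtop sphere3))"
    proof (rule inj_onI)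
      fix x y assume xy: "x \<in> topspace (mtop sphere3)" and eq: "(?\<pi> x, g x) = (?\<pi> y, g y)"
      have "y \<in> ?\<pi> y" unfolding \<pi> by (rule range_eqI[of _ _ 0]) simp
      then obtain k where k: "y = (lens_generator p q ^^ k) x" using eq by (auto simp: \<pi>)
      moreover have "lens_generator p q ^^ k = id"
        by (rule separates[of x]) (use xy eq k in \<open>simp_all add: top\<close>)
      ultimately show "x = y" by simp
    qed
  qed
  ultimately show ?thesis
    unfolding smooth_embedding_def by blast
qed

end
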